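(* Let $X$ be a set and $R:X\times X\to X\times X$ a map. For a map $f:X\to X$ write $R_f(x,y)=(y,f(x))$ for all $x,y\in X$. Then: (1) $R$ is a left non-degenerate solution on $X$ if and only if there exists a map $f:X\to X$ such that $R=R_f$. (2) $R$ is a right non-degenerate solution on $X$ if and only if there exists a bijective map $f:X\to X$ such that $R=R_f$. (3) Two solutions $(X,R_f)$ and $(X,R_g)$, where $f,g:X\to X$ are maps and $R_f(x,y)=(y,f(x))$, $R_g(x,y)=(y,g(x))$ for all $x,y\in X$, are isomorphic if and only if there exists $\sigma\in\Sigma_X$ such that $g=\sigma\circ f\circ\sigma^{-1}$. Furthermore, $\mathrm{Aut}(X,R_f)=\mathrm{Aut}(f)$. In particular, if $X$ is a finite set with $|X|=n$, then the number of isomorphism classes of all left (resp. right) non-degenerate solutions on $X$ is equal to $d(n)$, the Davis number of $n$ (resp. $p(n)$, the Euler partition number of $n$).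
   Context: All sets are non-empty. $\Sigma_X$ is the group of all permutations of $X$. For a set $X$ let $\tau_X(x,y)=(y,x)$ be the flip map on $X\times X$. For a map $R:X\times X\to X\times X$ put, as maps $X^3\to X^3$, $R^{12}=R\times \mathrm{Id}_X$, $R^{23}=\mathrm{Id}_X\times R$, $R^{13}=(\mathrm{Id}_X\times\tau_X)\circ R^{12}\circ(\mathrm{Id}_X\times\tau_X)$. $R$ is called a solution on $X$ (of the set-theoretic Frobenius-Separability equation) if $R^{12}R^{23}=R^{23}R^{13}=R^{13}R^{12}$. An isomorphism of solutions $(X,R)\to(X',R')$ is a bijection $\sigma:X\to X'$ with $(\sigma\times\sigma)\circ R=R'\circ(\sigma\times\sigma)$; $\mathrm{Aut}(X,R)$ is the group of automorphisms. Write $R(x,y)=(l_x(y),r_y(x))$. $R$ is left (resp. right) non-degenerate if $l_x:X\to X$ (resp. $r_x:X\to X$) is bijective for every $x\in X$. For $f:X\to X$, $\mathrm{Aut}(f)=\{\sigma\in\Sigma_X : \sigma\circ f=f\circ\sigma\}$. The Davis number $d(n)$ is the number of orbits of $S_n$ acting by conjugation $f\mapsto\sigma\circ f\circ\sigma^{-1}$ on all self-maps $f$ of an $n$-element set; $p(n)$ is the number of partitions of the integer $n$. *)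

theory Defs
  imports "HOL-Algebra.Group_Action" "HOL-Library.FuncSet" "HOL-Library.Multiset"
begin

text \<open>
  A set is an explicit carrier \<open>X\<close>.  A map \<open>X \<rightarrow> Y\<close> is an element of \<open>X \<rightarrow>\<^sub>E Y\<close>, so that each map
  has exactly one representative; equality and counting of maps are then the literal ones.
  The group \<open>\<Sigma>\<^sub>X\<close> of permutations of \<open>X\<close> is \<open>BijGroup X\<close>.
\<close>

text \<open>
  The maps \<open>R\<^sup>1\<^sup>2\<close>, \<open>R\<^sup>2\<^sup>3\<close>, \<open>R\<^sup>1\<^sup>3\<close> on triples.  They are only meaningful on \<open>X \<times> X \<times> X\<close>, and are
  only compared there.  Triples are right-nested pairs, hence the asymmetry between the first two.
\<close>

definition R12 :: "('a \<times> 'a \<Rightarrow> 'a \<times> 'a) \<Rightarrow> 'a \<times> 'a \<times> 'a \<Rightarrow> 'a \<times> 'a \<times> 'a" where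
  "R12 R = (\<lambda>(x, y, z). (fst (R (x, y)), snd (R (x, y)), z))"

definition R23 :: "('a \<times> 'a \<Rightarrow> 'a \<times> 'a) \<Rightarrow> 'a \<times> 'a \<times> 'a \<Rightarrow> 'a \<times> 'a \<times> 'a" where
  "R23 R = map_prod id R"

definition R13 :: "('a \<times> 'a \<Rightarrow> 'a \<times> 'a) \<Rightarrow> 'a \<times> 'a \<times> 'a \<Rightarrow> 'a \<times> 'a \<times> 'a" where
  "R13 R = map_prod id prod.swap \<circ> R12 R \<circ> map_prod id prod.swap"

definition FS_solution :: "'a set \<Rightarrow> ('a \<times> 'a \<Rightarrow> 'a \<times> 'a) \<Rightarrow> bool" where
  "FS_solution X R \<longleftrightarrow>
     R \<in> X \<times> X \<rightarrow>\<^sub>E X \<times> X \<and>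
     (\<forall>t \<in> X \<times> X \<times> X. (R12 R \<circ> R23 R) t = (R23 R \<circ> R13 R) t \<and>
                      (R23 R \<circ> R13 R) t = (R13 R \<circ> R12 R) t)"

text \<open>
  The components in \<open>R (x, y) = (l\<^sub>x y, r\<^sub>y x)\<close>; the index of \<open>r\<close> is the second argument of \<open>R\<close>.
\<close>

definition left_map :: "('a \<times> 'a \<Rightarrow> 'a \<times> 'a) \<Rightarrow> 'a \<Rightarrow> 'a \<Rightarrow> 'a" where
  "left_map R x y = fst (R (x, y))"

definition right_map :: "('a \<times> 'a \<Rightarrow> 'a \<times> 'a) \<Rightarrow> 'a \<Rightarrow> 'a \<Rightarrow> 'a" where
  "right_map R y x = snd (R (x, y))"

definition left_nondegenerate :: "'a set \<Rightarrow> ('a \<times> 'a \<Rightarrow> 'a \<times> 'a) \<Rightarrow> bool" where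
  "left_nondegenerate X R \<longleftrightarrow> (\<forall>x \<in> X. bij_betw (left_map R x) X X)"

definition right_nondegenerate :: "'a set \<Rightarrow> ('a \<times> 'a \<Rightarrow> 'a \<times> 'a) \<Rightarrow> bool" where
  "right_nondegenerate X R \<longleftrightarrow> (\<forall>x \<in> X. bij_betw (right_map R x) X X)"

definition solution_isos ::
  "'a set \<Rightarrow> ('a \<times> 'a \<Rightarrow> 'a \<times> 'a) \<Rightarrow> 'b set \<Rightarrow> ('b \<times> 'b \<Rightarrow> 'b \<times> 'b) \<Rightarrow> ('a \<Rightarrow> 'b) set" where
  "solution_isos X R X' R' =
     {\<sigma> \<in> X \<rightarrow>\<^sub>E X'. bij_betw \<sigma> X X' \<and>
        (\<forall>p \<in> X \<times> X. (map_prod \<sigma> \<sigma> \<circ> R) p = (R' \<circ> map_prod \<sigma> \<sigma>) p)}"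

definition isomorphic_solutions ::
  "'a set \<Rightarrow> ('a \<times> 'a \<Rightarrow> 'a \<times> 'a) \<Rightarrow> 'b set \<Rightarrow> ('b \<times> 'b \<Rightarrow> 'b \<times> 'b) \<Rightarrow> bool" where
  "isomorphic_solutions X R X' R' \<longleftrightarrow> solution_isos X R X' R' \<noteq> {}"

definition solution_Aut :: "'a set \<Rightarrow> ('a \<times> 'a \<Rightarrow> 'a \<times> 'a) \<Rightarrow> ('a \<Rightarrow> 'a) monoid" where
  "solution_Aut X R = (BijGroup X)\<lparr>carrier := solution_isos X R X R\<rparr>"

definition map_Aut :: "'a set \<Rightarrow> ('a \<Rightarrow> 'a) \<Rightarrow> ('a \<Rightarrow> 'a) monoid" where
  "map_Aut X f =
     (BijGroup X)\<lparr>carrier := {\<sigma> \<in> carrier (BijGroup X). compose X \<sigma> f = compose X f \<sigma>}\<rparr>"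

definition iso_classes ::
  "'a set \<Rightarrow> ('a \<times> 'a \<Rightarrow> 'a \<times> 'a) set \<Rightarrow> ('a \<times> 'a \<Rightarrow> 'a \<times> 'a) set set" where
  "iso_classes X \<R> = \<R> // {(R, S). R \<in> \<R> \<and> S \<in> \<R> \<and> isomorphic_solutions X R X S}"

definition R_of :: "'a set \<Rightarrow> ('a \<Rightarrow> 'a) \<Rightarrow> 'a \<times> 'a \<Rightarrow> 'a \<times> 'a" where
  "R_of X f = (\<lambda>(x, y) \<in> X \<times> X. (y, f x))"

definition conj_map :: "'a set \<Rightarrow> ('a \<Rightarrow> 'a) \<Rightarrow> ('a \<Rightarrow> 'a) \<Rightarrow> 'a \<Rightarrow> 'a" where
  "conj_map X \<sigma> = (\<lambda>f \<in> X \<rightarrow>\<^sub>E X. compose X (compose X \<sigma> f) (inv\<^bsub>BijGroup X\<^esub> \<sigma>))"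

definition davis_number :: "nat \<Rightarrow> nat" where
  "davis_number n =
     card (orbits (BijGroup {..<n}) ({..<n} \<rightarrow>\<^sub>E {..<n}) (conj_map {..<n}))"

text \<open>A partition of \<open>n\<close> is the multiset of its (positive) parts.\<close>

definition partition_number :: "nat \<Rightarrow> nat" where
  "partition_number n = card {P :: nat multiset. 0 \<notin># P \<and> \<Sum>\<^sub># P = n}"

end

theory Submission
  imports Defs "HOL-Combinatorics.Cycles"
begin

text \<open>
  Comparing components in the two equations of a solution gives
  \<open>l\<^sub>x (l\<^sub>y z) = l\<^sub>x z\<close> and \<open>r\<^sub>z (l\<^sub>x y) = r\<^sub>z y\<close>.  If the \<open>l\<^sub>x\<close> are injective, the first identity
  forces every \<open>l\<^sub>y\<close> to be the identity; if the \<open>r\<^sub>z\<close> are injective, the second one does.  Another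
  component then reads \<open>r\<^sub>z x = r\<^sub>y x\<close>, so \<open>r\<close> does not depend on its index and
  \<open>R (x, y) = (y, f x)\<close>.  Since \<open>R_of X f\<close> has the bijective left maps \<open>y \<mapsto> y\<close> and the right
  maps \<open>f\<close>, this settles both characterisations (\<open>left_nondegenerate_solution_iff\<close>,
  \<open>right_nondegenerate_solution_iff\<close>).

  A bijection \<open>\<sigma>\<close> intertwines \<open>R_of X f\<close> with \<open>R_of Y g\<close> exactly if \<open>\<sigma> (f x) = g (\<sigma> x)\<close> for all
  \<open>x\<close>, because the two first components always agree (\<open>solution_isos_R_of\<close>).  So isomorphism of
  solutions is conjugacy of maps, and automorphisms are the permutations that commute with \<open>f\<close>.

  The isomorphism classes of left non-degenerate solutions are therefore the conjugacy classes of
  all self-maps of \<open>X\<close>, which an enumeration of \<open>X\<close> carries to the orbits that the Davis number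
  counts.  The classes of right non-degenerate solutions are the conjugacy classes of permutations,
  and these correspond to partitions by the cycle type.  The cycle type is read off from the numbers
  of points of each least period: a cycle of length \<open>k\<close> contributes exactly \<open>k\<close> points of least
  period \<open>k\<close>.  These numbers are invariant under conjugacy by their very definition, and everything
  else about them (they are given by a partition, they determine the permutation up to conjugacy, all
  partitions occur) follows by removing or adding one cycle at a time.
\<close>

section \<open>Conjugate maps\<close>

text \<open>
  The two maps live on different sets so that cycles can be compared with a standard rotation, and
  self-maps of \<open>X\<close> with self-maps of \<open>{..<n}\<close>.  Only values on these sets matter, so that a map
  is restricted to an invariant subset by naming that subset.
\<close>
definition conjugate_maps :: "'a set \<Rightarrow> ('a \<Rightarrow> 'a) \<Rightarrow> 'b set \<Rightarrow> ('b \<Rightarrow> 'b) \<Rightarrow> bool" where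
  "conjugate_maps X f Y g \<longleftrightarrow> (\<exists>\<sigma>. bij_betw \<sigma> X Y \<and> (\<forall>x\<in>X. \<sigma> (f x) = g (\<sigma> x)))"

lemma conjugate_maps_cong:
  assumes "\<And>x. x \<in> X \<Longrightarrow> f x = g x"
  shows "conjugate_maps X f X g"
  unfolding conjugate_maps_def using assms by (intro exI[of _ id]) auto

lemma conjugate_maps_sym:
  assumes "conjugate_maps X f Y g" and "f \<in> X \<rightarrow> X"
  shows "conjugate_maps Y g X f"
proof -
  obtain \<sigma> where \<sigma>: "bij_betw \<sigma> X Y" "\<forall>x\<in>X. \<sigma> (f x) = g (\<sigma> x)"
    using assms(1) unfolding conjugate_maps_def by blast
  have "inv_into X \<sigma> (g y) = f (inv_into X \<sigma> y)" if "y \<in> Y" for y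
  proof -
    have x: "inv_into X \<sigma> y \<in> X" "\<sigma> (inv_into X \<sigma> y) = y"
      using \<sigma>(1) that by (auto simp: bij_betw_def inv_into_into f_inv_into_f)
    then have "g y = \<sigma> (f (inv_into X \<sigma> y))"
      using \<sigma>(2) by simp
    moreover have "f (inv_into X \<sigma> y) \<in> X"
      using x(1) assms(2) by auto
    ultimately show ?thesis
      using \<sigma>(1) by (simp add: bij_betw_def)
  qed
  with bij_betw_inv_into[OF \<sigma>(1)] show ?thesis
    unfolding conjugate_maps_def by blast
qed

lemma conjugate_maps_trans:
  assumes "conjugate_maps X f Y g" and "conjugate_maps Y g Z h"
  shows "conjugate_maps X f Z h"
proof -
  obtain \<sigma> where \<sigma>: "bij_betw \<sigma> X Y" "\<forall>x\<in>X. \<sigma> (f x) = g (\<sigma> x)"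
    using assms(1) unfolding conjugate_maps_def by blast
  obtain \<tau> where \<tau>: "bij_betw \<tau> Y Z" "\<forall>y\<in>Y. \<tau> (g y) = h (\<tau> y)"
    using assms(2) unfolding conjugate_maps_def by blast
  have "\<forall>x\<in>X. (\<tau> \<circ> \<sigma>) (f x) = h ((\<tau> \<circ> \<sigma>) x)"
    using \<sigma> \<tau>(2) by (auto simp: bij_betw_apply)
  with bij_betw_trans[OF \<sigma>(1) \<tau>(1)] show ?thesis
    unfolding conjugate_maps_def by blast
qed

lemma conjugate_maps_Un:
  assumes "conjugate_maps A f A' g" and "conjugate_maps B f B' g"
    and "A \<inter> B = {}" and "A' \<inter> B' = {}"
    and "f \<in> A \<rightarrow> A" and "f \<in> B \<rightarrow> B"
  shows "conjugate_maps (A \<union> B) f (A' \<union> B') g"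
proof -
  obtain \<sigma> where \<sigma>: "bij_betw \<sigma> A A'" "\<forall>x\<in>A. \<sigma> (f x) = g (\<sigma> x)"
    using assms(1) unfolding conjugate_maps_def by blast
  obtain \<tau> where \<tau>: "bij_betw \<tau> B B'" "\<forall>x\<in>B. \<tau> (f x) = g (\<tau> x)"
    using assms(2) unfolding conjugate_maps_def by blast
  define \<rho> where "\<rho> x = (if x \<in> A then \<sigma> x else \<tau> x)" for x
  have \<rho>_B: "\<rho> x = \<tau> x" if "x \<in> B" for x
    using that assms(3) by (auto simp: \<rho>_def)
  have "bij_betw \<rho> A A'"
    using \<sigma>(1) by (simp add: \<rho>_def cong: bij_betw_cong)
  moreover have "bij_betw \<rho> B B'"
    using \<tau>(1) \<rho>_B by (simp cong: bij_betw_cong)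
  ultimately have "bij_betw \<rho> (A \<union> B) (A' \<union> B')"
    using assms(4) by (rule bij_betw_combine)
  moreover have "\<rho> (f x) = g (\<rho> x)" if "x \<in> A \<union> B" for x
  proof (cases "x \<in> A")
    case True
    then show ?thesis using \<sigma>(2) assms(5) by (auto simp: \<rho>_def)
  next
    case False
    with that have "x \<in> B" "f x \<in> B" using assms(6) by auto
    then show ?thesis using \<tau>(2) \<rho>_B by simp
  qed
  ultimately show ?thesis
    unfolding conjugate_maps_def by blast
qed

lemma conjugate_maps_bij_betw:
  assumes "conjugate_maps X f Y g" and "bij_betw f X X"
  shows "bij_betw g Y Y"
proof -
  obtain \<sigma> where \<sigma>: "bij_betw \<sigma> X Y" "\<forall>x\<in>X. \<sigma> (f x) = g (\<sigma> x)"
    using assms(1) unfolding conjugate_maps_def by blast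
  have "bij_betw (\<sigma> \<circ> f) X Y"
    using assms(2) \<sigma>(1) by (rule bij_betw_trans)
  then have "bij_betw (g \<circ> \<sigma>) X Y"
    using \<sigma>(2) bij_betw_cong[of X "\<sigma> \<circ> f" "g \<circ> \<sigma>" Y] by simp
  then show ?thesis
    using bij_betw_comp_iff[OF \<sigma>(1), of g Y] by simp
qed

lemma transport_map:
  assumes "bij_betw \<sigma> X Y" and "f \<in> X \<rightarrow> X"
  obtains g where "g \<in> Y \<rightarrow>\<^sub>E Y" and "conjugate_maps X f Y g"
proof
  let ?g = "\<lambda>y\<in>Y. \<sigma> (f (inv_into X \<sigma> y))"
  have "inv_into X \<sigma> y \<in> X" if "y \<in> Y" for y
    using assms(1) that by (auto simp: bij_betw_def inv_into_into)
  then show "?g \<in> Y \<rightarrow>\<^sub>E Y"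
    using assms by (auto simp: bij_betw_apply Pi_iff)
  have "\<sigma> (f x) = ?g (\<sigma> x)" if "x \<in> X" for x
    using assms(1) that by (simp add: bij_betw_apply bij_betw_inv_into_left)
  then show "conjugate_maps X f Y ?g"
    unfolding conjugate_maps_def using assms(1) by blast
qed

lemma conjugate_maps_iff_BijGroup:
  assumes f: "f \<in> X \<rightarrow>\<^sub>E X" and g: "g \<in> X \<rightarrow>\<^sub>E X"
  shows "conjugate_maps X f X g \<longleftrightarrow>
    (\<exists>\<sigma> \<in> carrier (BijGroup X). g = compose X (compose X \<sigma> f) (inv\<^bsub>BijGroup X\<^esub> \<sigma>))"
proof
  assume "conjugate_maps X f X g"
  then obtain \<sigma> where \<sigma>: "bij_betw \<sigma> X X" "\<forall>x\<in>X. \<sigma> (f x) = g (\<sigma> x)"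
    unfolding conjugate_maps_def by blast
  let ?\<sigma> = "restrict \<sigma> X"
  have in_Bij: "?\<sigma> \<in> Bij X"
    using \<sigma>(1) by (simp add: Bij_def cong: bij_betw_cong)
  have "compose X (compose X ?\<sigma> f) (inv\<^bsub>BijGroup X\<^esub> ?\<sigma>) y = g y" for y
  proof (cases "y \<in> X")
    case True
    have x: "inv_into X ?\<sigma> y \<in> X"
      using in_Bij True by (rule Bij_inv_into_mem)
    have "?\<sigma> (inv_into X ?\<sigma> y) = y"
      using in_Bij True bij_betw_inv_into_right[of ?\<sigma> X X y] unfolding Bij_def by blast
    with x have "\<sigma> (inv_into X ?\<sigma> y) = y" by simp
    with x \<sigma>(2) f True show ?thesis
      by (auto simp: compose_def inv_BijGroup[OF in_Bij] PiE_iff)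
  next
    case False
    then show ?thesis using g by (auto simp: compose_def)
  qed
  then show "\<exists>\<sigma> \<in> carrier (BijGroup X). g = compose X (compose X \<sigma> f) (inv\<^bsub>BijGroup X\<^esub> \<sigma>)"
    using in_Bij by (intro bexI[of _ ?\<sigma>]) (auto simp: BijGroup_def)
next
  assume "\<exists>\<sigma> \<in> carrier (BijGroup X). g = compose X (compose X \<sigma> f) (inv\<^bsub>BijGroup X\<^esub> \<sigma>)"
  then obtain \<sigma> where in_Bij: "\<sigma> \<in> Bij X"
    and eq: "g = compose X (compose X \<sigma> f) (inv\<^bsub>BijGroup X\<^esub> \<sigma>)"
    by (auto simp: BijGroup_def)
  have bij: "bij_betw \<sigma> X X"
    using in_Bij by (simp add: Bij_def)
  have "\<sigma> (f x) = g (\<sigma> x)" if "x \<in> X" for x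
    unfolding eq using that bij
    by (simp add: compose_def inv_BijGroup[OF in_Bij] bij_betw_apply bij_betw_inv_into_left)
  then show "conjugate_maps X f X g"
    unfolding conjugate_maps_def using bij by blast
qed

text \<open>
  This replaces the group action in the definition of the Davis number by the relation
  \<open>conjugate_maps\<close>.
\<close>
lemma orbit_conj_map:
  assumes "f \<in> Y \<rightarrow>\<^sub>E Y"
  shows "orbit (BijGroup Y) (conj_map Y) f = {g \<in> Y \<rightarrow>\<^sub>E Y. conjugate_maps Y f Y g}"
proof -
  have conj_closed: "conj_map Y \<sigma> f \<in> Y \<rightarrow>\<^sub>E Y" if "\<sigma> \<in> carrier (BijGroup Y)" for \<sigma>
  proof -
    from that have \<sigma>: "\<sigma> \<in> Bij Y" by (simp add: BijGroup_def)
    have "\<sigma> (f (inv_into Y \<sigma> y)) \<in> Y" if "y \<in> Y" for y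
      using Bij_inv_into_mem[OF \<sigma> that] assms Bij_imp_funcset[OF \<sigma>] by auto
    then show ?thesis
      using assms Bij_inv_into_mem[OF \<sigma>]
      by (auto simp: conj_map_def compose_def inv_BijGroup[OF \<sigma>])
  qed
  then show ?thesis
    using conjugate_maps_iff_BijGroup[OF assms] assms
    by (auto simp: orbit_def conj_map_def)
qed

section \<open>Cycle types\<close>

text \<open>
  \<open>least_power f x\<close> is the least period of \<open>x\<close> under \<open>f\<close>.  The number of points of period \<open>k\<close> is
  used in place of the number of \<open>k\<close>-cycles, since it makes no reference to a decomposition into
  cycles.
\<close>
definition period_count :: "'a set \<Rightarrow> ('a \<Rightarrow> 'a) \<Rightarrow> nat \<Rightarrow> nat" where
  "period_count X f k = card {x \<in> X. least_power f x = k}"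

lemma period_count_Un:
  assumes "finite A" "finite B" "A \<inter> B = {}"
  shows "period_count (A \<union> B) f k = period_count A f k + period_count B f k"
proof -
  have "{x \<in> A \<union> B. least_power f x = k} = {x \<in> A. least_power f x = k} \<union> {x \<in> B. least_power f x = k}"
    by auto
  moreover have "card \<dots> = period_count A f k + period_count B f k"
    unfolding period_count_def using assms by (intro card_Un_disjoint) auto
  ultimately show ?thesis
    unfolding period_count_def by simp
qed

text \<open>
  From \<open>g\<^sup>n (\<sigma> x) = \<sigma> (f\<^sup>n x)\<close> and injectivity of \<open>\<sigma>\<close>, the iterates that fix \<open>x\<close> and \<open>\<sigma> x\<close> have the
  same exponents, so \<open>\<sigma>\<close> preserves least periods.
\<close>
lemma period_count_conjugate:
  assumes "conjugate_maps X f Y g" and "f \<in> X \<rightarrow> X"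
  shows "period_count X f k = period_count Y g k"
proof -
  obtain \<sigma> where \<sigma>: "bij_betw \<sigma> X Y" "\<forall>x\<in>X. \<sigma> (f x) = g (\<sigma> x)"
    using assms(1) unfolding conjugate_maps_def by blast
  have iter: "(f ^^ n) x \<in> X \<and> (g ^^ n) (\<sigma> x) = \<sigma> ((f ^^ n) x)" if "x \<in> X" for n x
    by (induction n) (use that \<sigma>(2) assms(2) in auto)
  have "(g ^^ n) (\<sigma> x) = \<sigma> x \<longleftrightarrow> (f ^^ n) x = x" if "x \<in> X" for n x
    using iter[OF that, of n] that \<sigma>(1) by (auto simp: bij_betw_def inj_on_eq_iff)
  then have "least_power g (\<sigma> x) = least_power f x" if "x \<in> X" for x
    unfolding least_power_def using that by simp
  then have "bij_betw \<sigma> {x \<in> X. least_power f x = k} {y \<in> Y. least_power g y = k}"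
    using \<sigma>(1) by (auto simp: bij_betw_def inj_on_def)
  then show ?thesis
    unfolding period_count_def by (rule bij_betw_same_card)
qed

text \<open>
  The rotation of \<open>{..<k}\<close> is the model of a cycle of length \<open>k\<close>: a subset \<open>B\<close> is such a cycle of
  \<open>f\<close> if \<open>f\<close> on \<open>B\<close> is conjugate to it.
\<close>
abbreviation rotation :: "nat \<Rightarrow> nat \<Rightarrow> nat" where
  "rotation k \<equiv> (\<lambda>i. Suc i mod k)"

lemma rotation_funcset: "rotation k \<in> {..<k} \<rightarrow> {..<k}"
  by auto

lemma bij_betw_rotation: "bij_betw (rotation k) {..<k} {..<k}"
proof -
  have "rotation k ` {..<k} = {..<k}"
  proof (cases k)
    case (Suc m)
    have "j \<in> rotation k ` {..<k}" if "j < k" for j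
    proof (cases j)
      case 0
      then show ?thesis using Suc by (intro image_eqI[of _ _ m]) auto
    next
      case (Suc i)
      then show ?thesis using that by (intro image_eqI[of _ _ i]) auto
    qed
    then show ?thesis by auto
  qed simp
  then show ?thesis
    by (simp add: bij_betw_def eq_card_imp_inj_on)
qed

lemma least_power_rotation:
  assumes "i < k"
  shows "least_power (rotation k) i = k"
proof -
  have iter: "(rotation k ^^ n) i = (i + n) mod k" for n
    by (induction n) (use assms in \<open>auto simp: mod_Suc_eq\<close>)
  have "(rotation k ^^ k) i = i" and "0 < k"
    using assms by (auto simp: iter)
  then have *: "(rotation k ^^ least_power (rotation k) i) i = i" "0 < least_power (rotation k) i"
    and le: "least_power (rotation k) i \<le> k"
    by (auto intro: least_powerI least_power_le)
  \<comment> \<open>the least period is positive, at most \<open>k\<close>, and a multiple of \<open>k\<close>\<close>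
  from *(1) have "(i + least_power (rotation k) i) mod k = i mod k"
    using assms by (simp add: iter)
  then have "k dvd least_power (rotation k) i"
    by (metis add_diff_cancel_left' le_add1 mod_eq_dvd_iff_nat)
  with * le show ?thesis
    by (meson dvd_imp_le le_antisym)
qed

lemma period_count_cycle:
  assumes "conjugate_maps {..<k} (rotation k) B f"
  shows "period_count B f j = (if j = k then k else 0)"
proof -
  have "period_count {..<k} (rotation k) j = (if j = k then k else 0)"
    unfolding period_count_def using least_power_rotation[of _ k]
    by (cases "j = k") (auto intro!: arg_cong[where f = card, of _ "{..<k}", simplified])
  with period_count_conjugate[OF assms rotation_funcset] show ?thesis by simp
qed

text \<open>
  The cycle is the orbit \<open>x, f x, f\<^sup>2 x, \<dots>\<close>.  By finiteness two of its points coincide, and as the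
  powers of \<open>f\<close> are injective on \<open>X\<close>, the orbit returns to \<open>x\<close> itself.  Cut off before the first
  return, \<open>i \<mapsto> f\<^sup>i x\<close> is injective and turns the rotation into \<open>f\<close>.
\<close>
lemma split_off_cycle:
  assumes "finite X" and f: "bij_betw f X X" and "x \<in> X"
  obtains B where "B \<subseteq> X" "x \<in> B" "bij_betw f B B" "bij_betw f (X - B) (X - B)"
    "0 < least_power f x"
    "conjugate_maps {..<least_power f x} (rotation (least_power f x)) B f"
proof -
  define e where "e i = (f ^^ i) x" for i
  define k where "k = least_power f x"
  have bij_pow: "bij_betw (f ^^ i) X X" for i
    using f by (rule bij_betw_funpow)
  have e_in: "e i \<in> X" for i
    using bij_betw_apply[OF bij_pow \<open>x \<in> X\<close>] by (simp add: e_def)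
  have returns: "(f ^^ (j - i)) x = x" if "e i = e j" "i \<le> j" for i j
  proof -
    have "(f ^^ i) ((f ^^ (j - i)) x) = (f ^^ i) x"
      using that by (simp add: e_def flip: funpow_add comp_apply[of "f ^^ i"])
    then show ?thesis
      using bij_pow[of i] e_in[of "j - i"] \<open>x \<in> X\<close> by (auto simp: bij_betw_def inj_on_eq_iff e_def)
  qed
  have "\<not> inj e"
    using \<open>finite X\<close> e_in by (meson finite_subset image_subsetI infinite_UNIV_nat finite_imageD)
  then obtain i j where "i < j" "e i = e j"
    by (metis injI linorder_neqE_nat)
  then have "(f ^^ (j - i)) x = x" "0 < j - i"
    using returns by auto
  then have k: "(f ^^ k) x = x" "0 < k"
    unfolding k_def by (auto intro: least_powerI)
  have "i = j" if "i < k" "j < k" "e i = e j" "i \<le> j" for i j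
    using returns[OF that(3,4)] least_power_le[of "j - i" f x] that by (force simp: k_def)
  then have inj: "inj_on e {..<k}"
    by (metis inj_onI lessThan_iff nat_le_linear)
  have step: "e (rotation k i) = f (e i)" if "i < k" for i
    using that k by (cases "Suc i = k") (auto simp: e_def)
  define B where "B = e ` {..<k}"
  have "bij_betw e {..<k} B"
    using inj by (simp add: B_def bij_betw_def)
  with step have conj: "conjugate_maps {..<k} (rotation k) B f"
    unfolding conjugate_maps_def by (intro exI[of _ e]) auto
  then have bij_B: "bij_betw f B B"
    using bij_betw_rotation by (rule conjugate_maps_bij_betw)
  have "B \<subseteq> X"
    using e_in by (auto simp: B_def)
  moreover have "x \<in> B"
    using k(2) unfolding B_def by (intro image_eqI[of _ _ 0]) (auto simp: e_def)
  moreover have "bij_betw f (X - B) (X - B)"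
    using f bij_B \<open>B \<subseteq> X\<close> inj_on_image_set_diff[of f X X B]
    by (auto simp: bij_betw_def intro: inj_on_subset)
  ultimately show ?thesis
    using that bij_B k(2) conj unfolding k_def by blast
qed

text \<open>
  A point \<open>x\<close> of least period \<open>k\<close> in \<open>X\<close> has, by equality of the counts, a counterpart in \<open>Y\<close>.  Their
  cycles are both conjugate to the rotation of \<open>{..<k}\<close>, and removing them lowers the counts on both
  sides by the same amount, so induction on the size of \<open>X\<close> takes care of the complements.
\<close>
lemma conjugate_if_period_count_eq:
  assumes "finite X" "finite Y" "bij_betw f X X" "bij_betw g Y Y"
    and "\<And>k. period_count X f k = period_count Y g k"
  shows "conjugate_maps X f Y g"
  using assms
proof (induction "card X" arbitrary: X Y rule: less_induct)
  case less
  show ?case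
  proof (cases "X = {}")
    case True
    have "least_power g y \<noteq> k" if "y \<in> Y" for y k
      using less.prems(5)[of k] less.prems(2) that True by (auto simp: period_count_def)
    then have "Y = {}" by blast
    with True show ?thesis by (simp add: conjugate_maps_def bij_betw_def)
  next
    case False
    then obtain x where "x \<in> X" by blast
    define k where "k = least_power f x"
    obtain B where B: "B \<subseteq> X" "x \<in> B" "bij_betw f B B" "bij_betw f (X - B) (X - B)"
      "conjugate_maps {..<k} (rotation k) B f"
      using split_off_cycle[OF less.prems(1,3) \<open>x \<in> X\<close>] unfolding k_def by metis
    have "period_count X f k \<noteq> 0"
      using \<open>x \<in> X\<close> less.prems(1) by (auto simp: period_count_def k_def)
    then have "period_count Y g k \<noteq> 0"
      using less.prems(5) by simp
    then obtain y where y: "y \<in> Y" "least_power g y = k"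
      unfolding period_count_def by (metis (mono_tags, lifting) card.empty empty_Collect_eq)
    obtain C where C: "C \<subseteq> Y" "bij_betw g C C" "bij_betw g (Y - C) (Y - C)"
      "conjugate_maps {..<k} (rotation k) C g"
      using split_off_cycle[OF less.prems(2,4) y(1)] unfolding y(2) by metis
    have split_X: "period_count X f j = period_count (X - B) f j + period_count B f j" for j
      using period_count_Un[of "X - B" B f j] less.prems(1) B(1)
      by (simp add: finite_subset Un_absorb2 Int_commute)
    have split_Y: "period_count Y g j = period_count (Y - C) g j + period_count C g j" for j
      using period_count_Un[of "Y - C" C g j] less.prems(2) C(1)
      by (simp add: finite_subset Un_absorb2 Int_commute)
    have "period_count (X - B) f j = period_count (Y - C) g j" for j
      using less.prems(5)[of j] split_X split_Y
        period_count_cycle[OF B(5)] period_count_cycle[OF C(4)] by simp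
    moreover have "card (X - B) < card X"
      using \<open>x \<in> X\<close> B(2) less.prems(1) by (intro psubset_card_mono) auto
    ultimately have rest: "conjugate_maps (X - B) f (Y - C) g"
      using less.hyps[of "X - B" "Y - C"] less.prems(1,2) B(4) C(3) by simp
    have "conjugate_maps B f C g"
      using conjugate_maps_sym[OF B(5) rotation_funcset] C(4) by (rule conjugate_maps_trans)
    with rest have "conjugate_maps (X - B \<union> B) f (Y - C \<union> C) g"
      using B(3,4) by (intro conjugate_maps_Un bij_betw_imp_funcset) auto
    then show ?thesis
      using B(1) C(1) by (simp add: Un_absorb2)
  qed
qed

text \<open>
  A \<open>k\<close>-cycle has \<open>k\<close> points of period \<open>k\<close>.  The equation at \<open>k = 0\<close> leaves \<open>count \<mu> 0\<close> open,
  which is why \<open>0\<close> is excluded separately.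
\<close>
definition has_cycle_type :: "'a set \<Rightarrow> ('a \<Rightarrow> 'a) \<Rightarrow> nat multiset \<Rightarrow> bool" where
  "has_cycle_type X f \<mu> \<longleftrightarrow> 0 \<notin># \<mu> \<and> (\<forall>k. period_count X f k = k * count \<mu> k)"

lemma has_cycle_type_unique:
  assumes "has_cycle_type X f \<mu>" "has_cycle_type X f \<nu>"
  shows "\<mu> = \<nu>"
proof (rule multiset_eqI)
  fix k
  show "count \<mu> k = count \<nu> k"
    using assms unfolding has_cycle_type_def
    by (cases "k = 0") (metis not_in_iff, metis mult_left_cancel)
qed

lemma has_cycle_type_conjugate:
  assumes "conjugate_maps X f Y g" "f \<in> X \<rightarrow> X"
  shows "has_cycle_type X f \<mu> \<longleftrightarrow> has_cycle_type Y g \<mu>"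
  using period_count_conjugate[OF assms] by (simp add: has_cycle_type_def)

lemma has_cycle_type_add_cycle:
  assumes "has_cycle_type A f \<mu>" "conjugate_maps {..<k} (rotation k) B f" "0 < k"
    and "finite A" "finite B" "A \<inter> B = {}"
  shows "has_cycle_type (A \<union> B) f (add_mset k \<mu>)"
  using assms(1,3) unfolding has_cycle_type_def
  by (simp add: period_count_Un[OF assms(4-6)] period_count_cycle[OF assms(2)])

lemma card_of_conjugate_rotation:
  assumes "conjugate_maps {..<k} r B f"
  shows "card B = k"
  using assms unfolding conjugate_maps_def by (auto dest: bij_betw_same_card)

lemma has_cycle_type_exists:
  assumes "finite X" "bij_betw f X X"
  shows "\<exists>\<mu>. has_cycle_type X f \<mu> \<and> \<Sum>\<^sub># \<mu> = card X"
  using assms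
proof (induction "card X" arbitrary: X rule: less_induct)
  case less
  show ?case
  proof (cases "X = {}")
    case True
    then show ?thesis by (intro exI[of _ "{#}"]) (simp add: has_cycle_type_def period_count_def)
  next
    case False
    then obtain x where "x \<in> X" by blast
    define k where "k = least_power f x"
    obtain B where B: "B \<subseteq> X" "x \<in> B" "bij_betw f (X - B) (X - B)" "0 < k"
      "conjugate_maps {..<k} (rotation k) B f"
      using split_off_cycle[OF less.prems \<open>x \<in> X\<close>] unfolding k_def by metis
    have "finite B" using B(1) less.prems(1) finite_subset by blast
    have "card (X - B) < card X"
      using \<open>x \<in> X\<close> B(2) less.prems(1) by (intro psubset_card_mono) auto
    then obtain \<mu> where \<mu>: "has_cycle_type (X - B) f \<mu>" "\<Sum>\<^sub># \<mu> = card (X - B)"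
      using less.hyps[of "X - B"] less.prems(1) B(3) by auto
    have "has_cycle_type (X - B \<union> B) f (add_mset k \<mu>)"
      using \<mu>(1) B(5,4) less.prems(1) \<open>finite B\<close> by (intro has_cycle_type_add_cycle) auto
    moreover have "\<Sum>\<^sub># (add_mset k \<mu>) = card X"
      using \<mu>(2) card_of_conjugate_rotation[OF B(5)] B(1) less.prems(1) \<open>finite B\<close>
        card_mono[OF less.prems(1) B(1)]
      by (simp add: card_Diff_subset)
    ultimately show ?thesis
      using B(1) by (auto simp: Un_absorb2)
  qed
qed

text \<open>
  By induction on the parts: reserve a subset \<open>B\<close> of size \<open>k\<close> for a new part \<open>k\<close>, transport the rotation
  to \<open>B\<close>, and let a permutation of the remaining cycle type act on the complement of \<open>B\<close>.
\<close>
lemma permutation_of_cycle_type: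
  assumes "finite X" "0 \<notin># \<mu>" "\<Sum>\<^sub># \<mu> = card X"
  shows "\<exists>f. bij_betw f X X \<and> has_cycle_type X f \<mu>"
  using assms
proof (induction \<mu> arbitrary: X)
  case empty
  then show ?case by (auto simp: has_cycle_type_def period_count_def)
next
  case (add k \<mu>)
  from add.prems obtain B where B: "B \<subseteq> X" "card B = k" "finite B"
    by (metis le_add1 obtain_subset_with_card_n sum_mset.add_mset)
  have "\<Sum>\<^sub># \<mu> = card (X - B)"
    using add.prems(3) B by (simp add: card_Diff_subset)
  then obtain f where f: "bij_betw f (X - B) (X - B)" "has_cycle_type (X - B) f \<mu>"
    using add.IH[of "X - B"] add.prems(1,2) by auto
  obtain e where "bij_betw e {..<k} B"
    using B(2,3) by (metis card_lessThan finite_lessThan finite_same_card_bij)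
  then obtain r where r: "r \<in> B \<rightarrow>\<^sub>E B" "conjugate_maps {..<k} (rotation k) B r"
    using rotation_funcset by (rule transport_map)
  define h where "h x = (if x \<in> B then r x else f x)" for x
  have conj_f: "conjugate_maps (X - B) f (X - B) h" and "conjugate_maps B r B h"
    by (rule conjugate_maps_cong, simp add: h_def)+
  with r(2) have conj_B: "conjugate_maps {..<k} (rotation k) B h"
    by (blast intro: conjugate_maps_trans)
  have "has_cycle_type (X - B) h \<mu>"
    using has_cycle_type_conjugate[OF conj_f bij_betw_imp_funcset[OF f(1)]] f(2) by simp
  then have "has_cycle_type (X - B \<union> B) h (add_mset k \<mu>)"
    using conj_B add.prems(1,2) B(3) by (intro has_cycle_type_add_cycle) auto
  moreover have "bij_betw h (X - B \<union> B) (X - B \<union> B)"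
    using conjugate_maps_bij_betw[OF conj_f f(1)]
      conjugate_maps_bij_betw[OF conj_B bij_betw_rotation]
    by (intro bij_betw_combine) auto
  ultimately show ?case
    using B(1) by (auto simp: Un_absorb2)
qed

definition cycle_type :: "'a set \<Rightarrow> ('a \<Rightarrow> 'a) \<Rightarrow> nat multiset" where
  "cycle_type X f = (THE \<mu>. has_cycle_type X f \<mu>)"

lemma cycle_typeI:
  assumes "has_cycle_type X f \<mu>"
  shows "cycle_type X f = \<mu>"
  unfolding cycle_type_def using assms
  by (rule the_equality) (use assms has_cycle_type_unique in blast)

lemma has_cycle_type_cycle_type:
  assumes "finite X" "bij_betw f X X"
  shows "has_cycle_type X f (cycle_type X f)" "\<Sum>\<^sub># (cycle_type X f) = card X"
  using has_cycle_type_exists[OF assms] cycle_typeI by blast+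

lemma cycle_type_eq_iff_conjugate:
  assumes "finite X" "bij_betw f X X" "bij_betw g X X"
  shows "cycle_type X f = cycle_type X g \<longleftrightarrow> conjugate_maps X f X g"
proof
  assume "cycle_type X f = cycle_type X g"
  then have "period_count X f k = period_count X g k" for k
    using has_cycle_type_cycle_type(1)[OF assms(1,2)] has_cycle_type_cycle_type(1)[OF assms(1,3)]
    by (simp add: has_cycle_type_def)
  then show "conjugate_maps X f X g"
    using assms by (intro conjugate_if_period_count_eq) auto
next
  assume "conjugate_maps X f X g"
  moreover have "f \<in> X \<rightarrow> X"
    using assms(2) by (auto simp: bij_betw_apply)
  ultimately have "has_cycle_type X f = has_cycle_type X g"
    by (intro ext has_cycle_type_conjugate)
  then show "cycle_type X f = cycle_type X g"
    by (simp add: cycle_type_def)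
qed

lemma cycle_type_image:
  assumes "finite X"
  shows "cycle_type X ` {f \<in> X \<rightarrow>\<^sub>E X. bij_betw f X X} = {P. 0 \<notin># P \<and> \<Sum>\<^sub># P = card X}"
proof (intro equalityI subsetI)
  fix \<mu> assume "\<mu> \<in> cycle_type X ` {f \<in> X \<rightarrow>\<^sub>E X. bij_betw f X X}"
  then show "\<mu> \<in> {P. 0 \<notin># P \<and> \<Sum>\<^sub># P = card X}"
    using has_cycle_type_cycle_type[OF assms] by (auto simp: has_cycle_type_def)
next
  fix \<mu> assume "\<mu> \<in> {P. 0 \<notin># P \<and> \<Sum>\<^sub># P = card X}"
  then obtain f where f: "bij_betw f X X" "has_cycle_type X f \<mu>"
    using permutation_of_cycle_type[OF assms] by blast
  have conj: "conjugate_maps X f X (restrict f X)"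
    by (rule conjugate_maps_cong) simp
  have "cycle_type X (restrict f X) = \<mu>"
    using f has_cycle_type_conjugate[OF conj] by (auto intro!: cycle_typeI simp: bij_betw_apply)
  moreover have "bij_betw (restrict f X) X X"
    using conjugate_maps_bij_betw[OF conj f(1)] .
  moreover have "restrict f X \<in> X \<rightarrow>\<^sub>E X"
    using f(1) by (auto simp: bij_betw_apply)
  ultimately show "\<mu> \<in> cycle_type X ` {f \<in> X \<rightarrow>\<^sub>E X. bij_betw f X X}"
    by blast
qed

section \<open>Non-degenerate solutions\<close>

lemma R_of_solution:
  assumes "f \<in> X \<rightarrow>\<^sub>E X"
  shows "FS_solution X (R_of X f)"
proof -
  have "R_of X f \<in> X \<times> X \<rightarrow>\<^sub>E X \<times> X"
    using assms by (auto simp: R_of_def)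
  moreover have "f x \<in> X" if "x \<in> X" for x
    using assms that by auto
  ultimately show ?thesis
    unfolding FS_solution_def by (auto simp: R12_def R23_def R13_def R_of_def)
qed

lemma left_nondegenerate_R_of: "left_nondegenerate X (R_of X f)"
  unfolding left_nondegenerate_def left_map_def R_of_def
  by (auto simp: bij_betw_def inj_on_def)

lemma right_nondegenerate_R_of:
  assumes "X \<noteq> {}"
  shows "right_nondegenerate X (R_of X f) \<longleftrightarrow> bij_betw f X X"
proof -
  have "bij_betw (right_map (R_of X f) y) X X \<longleftrightarrow> bij_betw f X X" if "y \<in> X" for y
    using that by (intro bij_betw_cong) (simp add: right_map_def R_of_def)
  with assms show ?thesis
    unfolding right_nondegenerate_def by blast
qed

text \<open>
  In the notation \<open>R (x, y) = (l\<^sub>x y, r\<^sub>y x)\<close>, the triple \<open>(x, y, z)\<close> is sent to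
  \<open>(l\<^sub>x (l\<^sub>y z), r\<^bsub>l\<^sub>y z\<^esub> x, r\<^sub>z y)\<close> by \<open>R\<^sup>1\<^sup>2 R\<^sup>2\<^sup>3\<close>, to \<open>(l\<^sub>x z, l\<^sub>y (r\<^sub>z x), \<dots>)\<close> by
  \<open>R\<^sup>2\<^sup>3 R\<^sup>1\<^sup>3\<close>, and to \<open>(\<dots>, r\<^sub>y x, r\<^sub>z (l\<^sub>x y))\<close> by \<open>R\<^sup>1\<^sup>3 R\<^sup>1\<^sup>2\<close>.
\<close>
lemma FS_solution_components:
  assumes "FS_solution X R" "x \<in> X" "y \<in> X" "z \<in> X"
  shows "left_map R x (left_map R y z) = left_map R x z"
    and "right_map R (left_map R y z) x = right_map R y x"
    and "right_map R z y = right_map R z (left_map R x y)"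
proof -
  have "(R12 R \<circ> R23 R) (x, y, z) = (R23 R \<circ> R13 R) (x, y, z)"
    "(R23 R \<circ> R13 R) (x, y, z) = (R13 R \<circ> R12 R) (x, y, z)"
    using assms unfolding FS_solution_def by blast+
  then show "left_map R x (left_map R y z) = left_map R x z"
    and "right_map R (left_map R y z) x = right_map R y x"
    and "right_map R z y = right_map R z (left_map R x y)"
    by (auto simp: R12_def R23_def R13_def left_map_def right_map_def map_prod_def
        split: prod.splits)
qed

text \<open>
  Once the left maps are trivial, the second component identity becomes \<open>r\<^sub>z x = r\<^sub>y x\<close>.  Hence the
  common right map can be read off on the diagonal.
\<close>
lemma solution_with_trivial_left_map:
  assumes sol: "FS_solution X R" and triv: "\<And>x y. x \<in> X \<Longrightarrow> y \<in> X \<Longrightarrow> left_map R x y = y"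
  shows "\<exists>f \<in> X \<rightarrow>\<^sub>E X. R = R_of X f"
proof
  have R: "R \<in> X \<times> X \<rightarrow>\<^sub>E X \<times> X"
    using sol by (simp add: FS_solution_def)
  define f where "f = (\<lambda>x\<in>X. snd (R (x, x)))"
  show "f \<in> X \<rightarrow>\<^sub>E X"
    using R by (fastforce simp: f_def PiE_iff mem_Times_iff)
  show "R = R_of X f"
  proof
    fix p
    show "R p = R_of X f p"
    proof (cases "p \<in> X \<times> X")
      case True
      then obtain x y where p: "p = (x, y)" "x \<in> X" "y \<in> X" by blast
      have "right_map R y x = right_map R x x"
        using FS_solution_components(2)[OF sol, of x x y] p triv by simp
      with triv[OF p(2,3)] show ?thesis
        unfolding p(1) using p(2,3)
        by (simp add: R_of_def f_def left_map_def right_map_def prod_eq_iff)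
    next
      case False
      then show ?thesis using PiE_arb[OF R] by (simp add: R_of_def)
    qed
  qed
qed

lemma left_nondegenerate_solution_iff:
  "FS_solution X R \<and> left_nondegenerate X R \<longleftrightarrow> (\<exists>f \<in> X \<rightarrow>\<^sub>E X. R = R_of X f)"
proof
  assume *: "FS_solution X R \<and> left_nondegenerate X R"
  have "left_map R y z = z" if "y \<in> X" "z \<in> X" for y z
  proof -
    have bij: "bij_betw (left_map R y) X X"
      using * that by (simp add: left_nondegenerate_def)
    then show ?thesis
      \<comment> \<open>cancel the outer map in \<open>l\<^sub>y (l\<^sub>y z) = l\<^sub>y z\<close>\<close>
      using FS_solution_components(1)[of X R y y z] * that bij_betw_apply[OF bij]
      by (auto simp: bij_betw_def inj_on_eq_iff)
  qed
  with * show "\<exists>f \<in> X \<rightarrow>\<^sub>E X. R = R_of X f"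
    using solution_with_trivial_left_map by blast
next
  assume "\<exists>f \<in> X \<rightarrow>\<^sub>E X. R = R_of X f"
  then show "FS_solution X R \<and> left_nondegenerate X R"
    using R_of_solution left_nondegenerate_R_of by blast
qed

lemma right_nondegenerate_solution_iff:
  assumes "X \<noteq> {}"
  shows "FS_solution X R \<and> right_nondegenerate X R \<longleftrightarrow>
    (\<exists>f \<in> X \<rightarrow>\<^sub>E X. bij_betw f X X \<and> R = R_of X f)"
proof
  assume *: "FS_solution X R \<and> right_nondegenerate X R"
  have R: "R \<in> X \<times> X \<rightarrow>\<^sub>E X \<times> X"
    using * by (simp add: FS_solution_def)
  have "left_map R x y = y" if "x \<in> X" "y \<in> X" for x y
  proof -
    have bij: "bij_betw (right_map R x) X X"
      using * that by (simp add: right_nondegenerate_def)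
    moreover have "left_map R x y \<in> X"
      using R that by (fastforce simp: left_map_def PiE_iff mem_Times_iff)
    ultimately show ?thesis
      \<comment> \<open>cancel \<open>r\<^sub>x\<close> in \<open>r\<^sub>x (l\<^sub>x y) = r\<^sub>x y\<close>\<close>
      using FS_solution_components(3)[of X R x y x] * that
      by (auto simp: bij_betw_def inj_on_eq_iff)
  qed
  with * obtain f where "f \<in> X \<rightarrow>\<^sub>E X" "R = R_of X f"
    using solution_with_trivial_left_map by blast
  with * show "\<exists>f \<in> X \<rightarrow>\<^sub>E X. bij_betw f X X \<and> R = R_of X f"
    using right_nondegenerate_R_of[OF assms] by blast
next
  assume "\<exists>f \<in> X \<rightarrow>\<^sub>E X. bij_betw f X X \<and> R = R_of X f"
  then show "FS_solution X R \<and> right_nondegenerate X R"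
    using R_of_solution right_nondegenerate_R_of[OF assms] by blast
qed

text \<open>
  At \<open>(x, y)\<close> the two sides of the isomorphism condition are \<open>(\<sigma> y, \<sigma> (f x))\<close> and
  \<open>(\<sigma> y, g (\<sigma> x))\<close>.
\<close>
lemma solution_isos_R_of:
  assumes "X \<noteq> {}"
  shows "solution_isos X (R_of X f) Y (R_of Y g) =
    {\<sigma> \<in> X \<rightarrow>\<^sub>E Y. bij_betw \<sigma> X Y \<and> (\<forall>x\<in>X. \<sigma> (f x) = g (\<sigma> x))}"
proof -
  have "(\<forall>p \<in> X \<times> X. (map_prod \<sigma> \<sigma> \<circ> R_of X f) p = (R_of Y g \<circ> map_prod \<sigma> \<sigma>) p) \<longleftrightarrow>
      (\<forall>x\<in>X. \<sigma> (f x) = g (\<sigma> x))" if "\<sigma> \<in> X \<rightarrow>\<^sub>E Y" for \<sigma>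
  proof -
    have "(map_prod \<sigma> \<sigma> \<circ> R_of X f) (x, y) = (R_of Y g \<circ> map_prod \<sigma> \<sigma>) (x, y) \<longleftrightarrow>
        \<sigma> (f x) = g (\<sigma> x)" if "x \<in> X" "y \<in> X" for x y
      using that PiE_mem[OF \<open>\<sigma> \<in> X \<rightarrow>\<^sub>E Y\<close>] by (simp add: R_of_def)
    with assms show ?thesis by blast
  qed
  then show ?thesis
    unfolding solution_isos_def by blast
qed

lemma isomorphic_R_of_iff:
  assumes "X \<noteq> {}" "f \<in> X \<rightarrow>\<^sub>E X"
  shows "isomorphic_solutions X (R_of X f) Y (R_of Y g) \<longleftrightarrow> conjugate_maps X f Y g"
proof
  assume "isomorphic_solutions X (R_of X f) Y (R_of Y g)"
  then show "conjugate_maps X f Y g"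
    unfolding isomorphic_solutions_def solution_isos_R_of[OF assms(1)] conjugate_maps_def by blast
next
  assume "conjugate_maps X f Y g"
  then obtain \<sigma> where \<sigma>: "bij_betw \<sigma> X Y" "\<forall>x\<in>X. \<sigma> (f x) = g (\<sigma> x)"
    unfolding conjugate_maps_def by blast
  have "restrict \<sigma> X \<in> solution_isos X (R_of X f) Y (R_of Y g)"
    unfolding solution_isos_R_of[OF assms(1)]
    using \<sigma> assms(2) by (auto simp: bij_betw_apply PiE_iff cong: bij_betw_cong)
  then show "isomorphic_solutions X (R_of X f) Y (R_of Y g)"
    unfolding isomorphic_solutions_def by blast
qed

lemma solution_Aut_R_of:
  assumes "X \<noteq> {}" "f \<in> X \<rightarrow>\<^sub>E X"
  shows "solution_Aut X (R_of X f) = map_Aut X f"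
proof -
  have "compose X \<sigma> f = compose X f \<sigma> \<longleftrightarrow> (\<forall>x\<in>X. \<sigma> (f x) = f (\<sigma> x))" for \<sigma>
    by (auto simp: compose_def fun_eq_iff)
  then have "solution_isos X (R_of X f) X (R_of X f) =
      {\<sigma> \<in> carrier (BijGroup X). compose X \<sigma> f = compose X f \<sigma>}"
    unfolding solution_isos_R_of[OF assms(1)]
    by (auto simp: BijGroup_def Bij_def PiE_iff bij_betw_apply)
  then show ?thesis
    by (simp add: solution_Aut_def map_Aut_def)
qed

section \<open>Counting isomorphism classes\<close>

lemma card_quotient_by_invariant:
  assumes "\<And>x y. x \<in> A \<Longrightarrow> y \<in> A \<Longrightarrow> (x, y) \<in> r \<longleftrightarrow> t x = t y" and "r \<subseteq> A \<times> A"
  shows "card (A // r) = card (t ` A)"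
proof -
  let ?fibre = "\<lambda>b. {a \<in> A. t a = b}"
  have "r `` {x} = ?fibre (t x)" if "x \<in> A" for x
    using assms that by auto
  then have "A // r = ?fibre ` t ` A"
    by (auto simp: quotient_def)
  moreover have "inj_on ?fibre (t ` A)"
    by (rule inj_onI) blast
  ultimately show ?thesis
    by (simp add: card_image)
qed

text \<open>
  Any complete conjugacy invariant \<open>t\<close> counts the classes: it becomes a complete invariant of
  solutions through the inverse of \<open>R_of X\<close>, which takes the second component of \<open>R\<close> on the diagonal.
\<close>
lemma card_iso_classes:
  assumes "X \<noteq> {}" "F \<subseteq> X \<rightarrow>\<^sub>E X"
    and inv: "\<And>f g. f \<in> F \<Longrightarrow> g \<in> F \<Longrightarrow> conjugate_maps X f X g \<longleftrightarrow> t f = t g"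
  shows "card (iso_classes X (R_of X ` F)) = card (t ` F)"
proof -
  define map_of where "map_of R = (\<lambda>x\<in>X. snd (R (x, x)))" for R :: "'a \<times> 'a \<Rightarrow> 'a \<times> 'a"
  have map_of: "map_of (R_of X f) = f" if "f \<in> F" for f
  proof
    fix x
    have "f \<in> X \<rightarrow>\<^sub>E X" using that assms(2) by blast
    then show "map_of (R_of X f) x = f x"
      by (cases "x \<in> X") (auto simp: map_of_def R_of_def)
  qed
  have "isomorphic_solutions X R X S \<longleftrightarrow> t (map_of R) = t (map_of S)"
    if RS: "R \<in> R_of X ` F" "S \<in> R_of X ` F" for R S
  proof -
    obtain f g where fg: "f \<in> F" "R = R_of X f" "g \<in> F" "S = R_of X g"
      using RS by blast
    then have "f \<in> X \<rightarrow>\<^sub>E X" using assms(2) by blast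
    then have "isomorphic_solutions X R X S \<longleftrightarrow> conjugate_maps X f X g"
      unfolding fg(2,4) by (rule isomorphic_R_of_iff[OF assms(1)])
    with fg show ?thesis
      using inv map_of by simp
  qed
  then have "card (iso_classes X (R_of X ` F)) = card ((t \<circ> map_of) ` R_of X ` F)"
    unfolding iso_classes_def by (intro card_quotient_by_invariant) auto
  also have "(t \<circ> map_of) ` R_of X ` F = t ` F"
    using map_of by (auto simp: image_image intro!: image_cong)
  finally show ?thesis .
qed

text \<open>
  The complete invariant of \<open>f\<close> is the set of all self-maps of \<open>{..<n}\<close> conjugate to it.  Transport
  along an enumeration of \<open>X\<close> shows that this set is always an orbit, and that every orbit arises.
\<close>
lemma card_left_nondegenerate_classes:
  assumes "X \<noteq> {}" "finite X"
  shows "card (iso_classes X {R. FS_solution X R \<and> left_nondegenerate X R}) = davis_number (card X)"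
proof -
  let ?N = "{..<card X}"
  define t where "t f = {g \<in> ?N \<rightarrow>\<^sub>E ?N. conjugate_maps X f ?N g}" for f
  obtain \<sigma> where \<sigma>: "bij_betw \<sigma> X ?N"
    using finite_same_card_bij[of X ?N] assms(2) by auto
  have t_eq: "t f = orbit (BijGroup ?N) (conj_map ?N) g"
    if "f \<in> X \<rightarrow> X" "g \<in> ?N \<rightarrow>\<^sub>E ?N" "conjugate_maps X f ?N g" for f g
    unfolding orbit_conj_map[OF that(2)] t_def
    using conjugate_maps_trans[OF that(3)] conjugate_maps_trans[OF conjugate_maps_sym[OF that(3,1)]]
    by blast
  have "t f = t g \<longleftrightarrow> conjugate_maps X f X g" if fg: "f \<in> X \<rightarrow>\<^sub>E X" "g \<in> X \<rightarrow>\<^sub>E X" for f g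
  proof
    assume eq: "t f = t g"
    have "f \<in> X \<rightarrow> X" and g: "g \<in> X \<rightarrow> X" using fg by auto
    from \<sigma> this(1) obtain h where "h \<in> ?N \<rightarrow>\<^sub>E ?N" "conjugate_maps X f ?N h"
      by (rule transport_map)
    then have "conjugate_maps X f ?N h" "conjugate_maps X g ?N h"
      using eq by (auto simp: t_def)
    then show "conjugate_maps X f X g"
      using conjugate_maps_trans conjugate_maps_sym[OF _ g] by blast
  next
    assume conj: "conjugate_maps X f X g"
    then have "conjugate_maps X g X f"
      using fg(1) by (auto intro: conjugate_maps_sym)
    with conj show "t f = t g"
      unfolding t_def using conjugate_maps_trans by blast
  qed
  then have "card (iso_classes X (R_of X ` (X \<rightarrow>\<^sub>E X))) = card (t ` (X \<rightarrow>\<^sub>E X))"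
    using assms(1) by (intro card_iso_classes) auto
  also have "t ` (X \<rightarrow>\<^sub>E X) = orbits (BijGroup ?N) (?N \<rightarrow>\<^sub>E ?N) (conj_map ?N)"
  proof (intro equalityI subsetI)
    fix c assume "c \<in> t ` (X \<rightarrow>\<^sub>E X)"
    then obtain f where f: "f \<in> X \<rightarrow> X" "c = t f" by auto
    from \<sigma> f(1) obtain g where "g \<in> ?N \<rightarrow>\<^sub>E ?N" "conjugate_maps X f ?N g"
      by (rule transport_map)
    with t_eq f show "c \<in> orbits (BijGroup ?N) (?N \<rightarrow>\<^sub>E ?N) (conj_map ?N)"
      unfolding orbits_def by blast
  next
    fix c assume "c \<in> orbits (BijGroup ?N) (?N \<rightarrow>\<^sub>E ?N) (conj_map ?N)"
    then obtain g where g: "g \<in> ?N \<rightarrow>\<^sub>E ?N" "c = orbit (BijGroup ?N) (conj_map ?N) g"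
      unfolding orbits_def by blast
    then have g': "g \<in> ?N \<rightarrow> ?N" by auto
    from bij_betw_inv_into[OF \<sigma>] g' obtain f
      where f: "f \<in> X \<rightarrow>\<^sub>E X" "conjugate_maps ?N g X f"
      by (rule transport_map)
    then have "conjugate_maps X f ?N g"
      using g' by (blast intro: conjugate_maps_sym)
    with f(1) g have "c = t f"
      using t_eq[of f g] by auto
    with f(1) show "c \<in> t ` (X \<rightarrow>\<^sub>E X)" by blast
  qed
  also have "R_of X ` (X \<rightarrow>\<^sub>E X) = {R. FS_solution X R \<and> left_nondegenerate X R}"
    unfolding left_nondegenerate_solution_iff by blast
  finally show ?thesis
    unfolding davis_number_def .
qed

lemma card_right_nondegenerate_classes:
  assumes "X \<noteq> {}" "finite X"
  shows "card (iso_classes X {R. FS_solution X R \<and> right_nondegenerate X R}) =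
    partition_number (card X)"
proof -
  let ?F = "{f \<in> X \<rightarrow>\<^sub>E X. bij_betw f X X}"
  have "card (iso_classes X (R_of X ` ?F)) = card (cycle_type X ` ?F)"
    using assms cycle_type_eq_iff_conjugate by (intro card_iso_classes) auto
  moreover have "R_of X ` ?F = {R. FS_solution X R \<and> right_nondegenerate X R}"
    unfolding right_nondegenerate_solution_iff[OF assms(1)] by blast
  ultimately show ?thesis
    unfolding partition_number_def cycle_type_image[OF assms(2)] by simp
qed

theorem theorem2p19:
  fixes X :: "'a set" and R :: "'a \<times> 'a \<Rightarrow> 'a \<times> 'a"
  assumes "X \<noteq> {}" and "R \<in> X \<times> X \<rightarrow>\<^sub>E X \<times> X"
  shows
    "(FS_solution X R \<and> left_nondegenerate X R \<longleftrightarrow> (\<exists>f \<in> X \<rightarrow>\<^sub>E X. R = R_of X f)) \<and>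
     (FS_solution X R \<and> right_nondegenerate X R \<longleftrightarrow>
        (\<exists>f \<in> X \<rightarrow>\<^sub>E X. bij_betw f X X \<and> R = R_of X f)) \<and>
     (\<forall>f \<in> X \<rightarrow>\<^sub>E X. \<forall>g \<in> X \<rightarrow>\<^sub>E X.
        isomorphic_solutions X (R_of X f) X (R_of X g) \<longleftrightarrow>
          (\<exists>\<sigma> \<in> carrier (BijGroup X).
             g = compose X (compose X \<sigma> f) (inv\<^bsub>BijGroup X\<^esub> \<sigma>))) \<and>
     (\<forall>f \<in> X \<rightarrow>\<^sub>E X. solution_Aut X (R_of X f) = map_Aut X f) \<and>
     (\<forall>n. finite X \<and> card X = n \<longrightarrow>
        card (iso_classes X {R. FS_solution X R \<and> left_nondegenerate X R}) = davis_number n \<and>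
        card (iso_classes X {R. FS_solution X R \<and> right_nondegenerate X R}) = partition_number n)"
proof (intro conjI ballI)
  show "FS_solution X R \<and> left_nondegenerate X R \<longleftrightarrow> (\<exists>f \<in> X \<rightarrow>\<^sub>E X. R = R_of X f)"
    by (rule left_nondegenerate_solution_iff)
  show "FS_solution X R \<and> right_nondegenerate X R \<longleftrightarrow>
      (\<exists>f \<in> X \<rightarrow>\<^sub>E X. bij_betw f X X \<and> R = R_of X f)"
    using assms(1) by (rule right_nondegenerate_solution_iff)
  show "isomorphic_solutions X (R_of X f) X (R_of X g) \<longleftrightarrow>
      (\<exists>\<sigma> \<in> carrier (BijGroup X). g = compose X (compose X \<sigma> f) (inv\<^bsub>BijGroup X\<^esub> \<sigma>))"
    if "f \<in> X \<rightarrow>\<^sub>E X" "g \<in> X \<rightarrow>\<^sub>E X" for f g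
    unfolding isomorphic_R_of_iff[OF assms(1) that(1)] by (rule conjugate_maps_iff_BijGroup[OF that])
  show "solution_Aut X (R_of X f) = map_Aut X f" if "f \<in> X \<rightarrow>\<^sub>E X" for f
    using assms(1) that by (rule solution_Aut_R_of)
  show "\<forall>n. finite X \<and> card X = n \<longrightarrow>
      card (iso_classes X {R. FS_solution X R \<and> left_nondegenerate X R}) = davis_number n \<and>
      card (iso_classes X {R. FS_solution X R \<and> right_nondegenerate X R}) = partition_number n"
    using card_left_nondegenerate_classes[OF assms(1)]
      card_right_nondegenerate_classes[OF assms(1)] by blast
qed

end
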